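(* For all integers $m<0$ and $n\geq 1$, \[ M(\leq m,n)\leq N(\leq m+1,n). \]
   Context: For a partition $\lambda$, $\operatorname{rank}(\lambda)$ is its largest part minus its number of parts. $\operatorname{crank}(\lambda)$ is the largest part of $\lambda$ if $\lambda$ contains no part equal to $1$; otherwise it is the number of parts larger than the number of ones minus the number of ones. For $n\geq 1$, $N(m,n)$ is the number of partitions of $n$ with rank $m$. For $n>1$, $M(m,n)$ is the number of partitions of $n$ with crank $m$. For $n=1$ one sets $M(0,1)=-1$, $M(1,1)=M(-1,1)=1$ and $M(m,1)=0$ for $m\notin\{-1,0,1\}$. The cumulative functions are $N(\leq m,n)=\sum_{r\leq m}N(r,n)$ and $M(\leq m,n)=\sum_{r\leq m}M(r,n)$. *)

theory Defs
  imports Main "HOL-Library.Multiset"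
begin

definition partitions :: "nat \<Rightarrow> nat multiset set" where
  "partitions n = {p. (\<forall>x\<in>#p. 0 < x) \<and> sum_mset p = n}"

definition largest_part :: "nat multiset \<Rightarrow> nat" where
  "largest_part p = (if p = {#} then 0 else Max (set_mset p))"

definition prank :: "nat multiset \<Rightarrow> int" where
  "prank p = int (largest_part p) - int (size p)"

definition pcrank :: "nat multiset \<Rightarrow> int" where
  "pcrank p = (if count p 1 = 0 then int (largest_part p)
               else int (size (filter_mset (\<lambda>x. count p 1 < x) p)) - int (count p 1))"

definition Nrank :: "int \<Rightarrow> nat \<Rightarrow> int" where
  "Nrank m n = int (card {p \<in> partitions n. prank p = m})"

definition Mcrank :: "int \<Rightarrow> nat \<Rightarrow> int" where
  "Mcrank m n = (if n = 1 then (if m = 0 then -1 else if m = 1 \<or> m = -1 then 1 else 0)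
                 else int (card {p \<in> partitions n. pcrank p = m}))"

text \<open>Cumulative functions: sum over all r \<le> m (only finitely many nonzero terms).\<close>
definition Nrank_le :: "int \<Rightarrow> nat \<Rightarrow> int" where
  "Nrank_le m n = (\<Sum>r\<in>{r. r \<le> m \<and> Nrank r n \<noteq> 0}. Nrank r n)"

definition Mcrank_le :: "int \<Rightarrow> nat \<Rightarrow> int" where
  "Mcrank_le m n = (\<Sum>r\<in>{r. r \<le> m \<and> Mcrank r n \<noteq> 0}. Mcrank r n)"

end

theory Submission
  imports Defs Complex_Main
begin

text \<open>
  Write $k = -m$. In terms of Frobenius symbols $(p \mid h)$, let $F_k(n)$ be the number of partitions
  of $n$ with $k \in p$, and let $G_k(n)$ be the number of those with $\max h \ge \max p + k + 2$, that is, with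
  rank at most $-(k+2)$. Redistributing ones sends the partitions of $n$ with crank at most $-k$ injectively to the
  partitions of $n - k$ with $k \notin p$. Dyson's map (remove the first row, add a column of
  length $k$ more) sends the partitions of $n - k$ with rank at least $-(k+1)$ injectively to the
  partitions of $n$ with rank at most $-(k-1)$. By complementation the theorem follows from $G_k \le F_k$.

  For this, exchange $p$ and $h$ in the symbols counted by $G_k$. If $k \in p$ there is nothing to do; otherwise
  the largest element $k+d+1$ of $p$ is traded for $k$ in $p$ and a new largest element, $d$ or $d+1$, of $h$.
  If $0 \in h$, this $0$ is dropped to keep the two sets equinumerous; if not, $0$ is added to $h$ and one element has
  to move from $h$ to $p$. On the set of elements that lie in exactly one of $p$ and $h$ and that may be moved, this
  is an injection from $u$-subsets to $(u-1)$-subsets, which exists because $u$ exceeds half the size of the set,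
  except in one family of cases that is handled by exchanging $p$ and $h$ once more.
\<close>

section \<open>Injections from larger to smaller subsets of a finite set\<close>

lemma exists_inj_lower_subsets:
  fixes Y :: "'a set"
  assumes "finite Y" "card Y < 2 * u"
  shows "\<exists>f. inj_on f {A. A \<subseteq> Y \<and> card A = u}
    \<and> f ` {A. A \<subseteq> Y \<and> card A = u} \<subseteq> {A. A \<subseteq> Y \<and> card A = u - 1}"
proof -
  have "card {A. A \<subseteq> Y \<and> card A = u} \<le> card {A. A \<subseteq> Y \<and> card A = u - 1}"
  proof (cases "u \<le> card Y")
    case True
    \<comment> \<open>Since \<open>card Y < 2 * u\<close>, already \<open>u - 1\<close> is at least
      \<open>card Y div 2\<close>, and from there on the binomial coefficients decrease.\<close>
    have "card Y choose u \<le> card Y choose (u - 1)"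
      by (rule binomial_antimono) (use assms True in auto)
    then show ?thesis using assms(1) by (simp add: n_subsets)
  qed (use assms(1) in \<open>simp add: n_subsets binomial_eq_0\<close>)
  from card_le_inj[OF _ _ this] assms(1) show ?thesis by (simp add: conj_commute)
qed

text \<open>
  Any injection will do: replacing the part of $h$ inside a fixed set $Y$ by another subset of $Y$,
  and the part of $p$ by its complement in $Y$, leaves $\sum p + \sum h$ unchanged.
\<close>
definition lower_subset_of :: "'a set \<Rightarrow> nat \<Rightarrow> 'a set \<Rightarrow> 'a set" where
  "lower_subset_of Y u = (SOME f. inj_on f {A. A \<subseteq> Y \<and> card A = u}
    \<and> f ` {A. A \<subseteq> Y \<and> card A = u} \<subseteq> {A. A \<subseteq> Y \<and> card A = u - 1})"

definition lower_subset :: "'a set \<Rightarrow> 'a set \<Rightarrow> 'a set" where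
  "lower_subset Y A = lower_subset_of Y (card A) A"

lemma lower_subset_of:
  assumes "finite Y" "card Y < 2 * u"
  shows "inj_on (lower_subset_of Y u) {A. A \<subseteq> Y \<and> card A = u}"
    and "lower_subset_of Y u ` {A. A \<subseteq> Y \<and> card A = u} \<subseteq> {A. A \<subseteq> Y \<and> card A = u - 1}"
proof -
  note spec = someI_ex[OF exists_inj_lower_subsets[OF assms], folded lower_subset_of_def]
  show "inj_on (lower_subset_of Y u) {A. A \<subseteq> Y \<and> card A = u}"
    by (rule conjunct1[OF spec])
  show "lower_subset_of Y u ` {A. A \<subseteq> Y \<and> card A = u} \<subseteq> {A. A \<subseteq> Y \<and> card A = u - 1}"
    by (rule conjunct2[OF spec])
qed

lemma lower_subset:
  assumes "finite Y" "A \<subseteq> Y" "card Y < 2 * card A"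
  shows "lower_subset Y A \<subseteq> Y" "Suc (card (lower_subset Y A)) = card A"
proof -
  have "lower_subset Y A \<in> {B. B \<subseteq> Y \<and> card B = card A - 1}"
    unfolding lower_subset_def
    by (rule subsetD[OF lower_subset_of(2)[OF assms(1,3)]], rule imageI) (use assms(2) in simp)
  then have *: "lower_subset Y A \<subseteq> Y" "card (lower_subset Y A) = card A - 1" by blast+
  from *(1) show "lower_subset Y A \<subseteq> Y" .
  from *(2) assms(3) show "Suc (card (lower_subset Y A)) = card A" by linarith
qed

text \<open>Images of sets of different sizes have different sizes, so the injections chosen for
  each size glue to a single one.\<close>

lemma lower_subset_inject:
  assumes Y: "finite Y" and A: "A \<subseteq> Y" "card Y < 2 * card A"
    and B: "B \<subseteq> Y" "card Y < 2 * card B" and eq: "lower_subset Y A = lower_subset Y B"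
  shows "A = B"
proof -
  have c: "card A = card B"
    using lower_subset(2)[OF Y A] lower_subset(2)[OF Y B] eq by simp
  show ?thesis
  proof (rule inj_onD[OF lower_subset_of(1)[OF Y A(2)]])
    show "lower_subset_of Y (card A) A = lower_subset_of Y (card A) B"
      using eq unfolding lower_subset_def c .
  qed (use A(1) B(1) c in auto)
qed

section \<open>Pairs of finite sets\<close>

text \<open>
  A triple of the first kind stands for the pair $(p \cup \{k+d+1\}, h)$, one of the second kind
  for the pair $(p \cup \{k\}, h \cup \{d\})$; in both cases the size of the partition is $N + k + 1$.
\<close>
definition skew_triples :: "nat \<Rightarrow> nat \<Rightarrow> (nat \<times> nat set \<times> nat set) set" where
  "skew_triples k N = {(d, p, h). p \<subseteq> {..k + d} - {k} \<and> h \<subseteq> {..<d} \<and> card h = Suc (card p)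
    \<and> d + \<Sum>p + \<Sum>h + card h = N}"

definition even_triples :: "nat \<Rightarrow> nat \<Rightarrow> (nat \<times> nat set \<times> nat set) set" where
  "even_triples k N = {(d, p, h). p \<subseteq> {..k + d} - {k} \<and> h \<subseteq> {..<d} \<and> card h = card p
    \<and> d + \<Sum>p + \<Sum>h + card h = N}"

lemma finite_triples: "finite (skew_triples k N \<union> even_triples k N)"
proof (rule finite_subset)
  show "skew_triples k N \<union> even_triples k N \<subseteq> {..N} \<times> Pow {..k + N} \<times> Pow {..N}"
  proof
    fix t assume t: "t \<in> skew_triples k N \<union> even_triples k N"
    obtain d p h where tdef: "t = (d, p, h)" by (cases t)
    then have "d \<le> N" "p \<subseteq> {..k + d}" "h \<subseteq> {..<d}" using t by (auto simp: skew_triples_def even_triples_def)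
    moreover have "{..k + d} \<subseteq> {..k + N}" "{..<d} \<subseteq> {..N}" using \<open>d \<le> N\<close> by auto
    ultimately have "d \<in> {..N}" "p \<subseteq> {..k + N}" "h \<subseteq> {..N}" by auto
    then show "t \<in> {..N} \<times> Pow {..k + N} \<times> Pow {..N}" by (simp add: tdef)
  qed
  show "finite ({..N} \<times> Pow {..k + N} \<times> Pow {..N})" by simp
qed

lemma finite_skew_triples: "finite (skew_triples k N)" and finite_even_triples: "finite (even_triples k N)"
  using finite_triples by auto

text \<open>
  The triples in \<open>low_skew_k\<close> are the only ones with $0 \notin h$ for which $h$ need not have enough
  elements that can be moved to $p$. Raising $d$ by $k$ and trading $k \in h$ for $0$ in both sets
  sends them to \<open>low_even_0\<close>. The triples in \<open>low_skew_0\<close>, which would have been sent there, exchange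
  their two sets instead and fill \<open>low_even_k\<close>.
\<close>
definition low_skew_k :: "nat \<Rightarrow> (nat \<times> nat set \<times> nat set) set" where
  "low_skew_k k = {(d, p, h). (0::nat) \<notin> h \<and> 0 \<notin> p \<and> (k::nat) \<in> h \<and> p \<subseteq> {..<d}}"

definition low_skew_0 :: "nat \<Rightarrow> (nat \<times> nat set \<times> nat set) set" where
  "low_skew_0 k = {(d, p, h). (0::nat) \<notin> h \<and> 0 \<in> p \<and> (k::nat) \<notin> h \<and> 2 * k < d \<and> p \<union> h \<subseteq> {..<d - k}}"

definition low_even_0 :: "nat \<Rightarrow> (nat \<times> nat set \<times> nat set) set" where
  "low_even_0 k = {(d, p, h). (0::nat) \<in> h \<and> 0 \<in> p \<and> (k::nat) \<notin> h \<and> 2 * k < d \<and> p \<union> h \<subseteq> {..<d - k}}"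

definition low_even_k :: "nat \<Rightarrow> (nat \<times> nat set \<times> nat set) set" where
  "low_even_k k = {(d, p, h). (0::nat) \<in> h \<and> 0 \<notin> p \<and> (k::nat) \<in> h \<and> p \<subseteq> {..<d}}"

definition zero_in_h :: "(nat \<times> nat set \<times> nat set) set" where
  "zero_in_h = {(d::nat, p::nat set, h). (0::nat) \<in> h}"

text \<open>Elements from \<open>d\<close> on may not enter \<open>h\<close>, \<open>k\<close> may
  not enter \<open>p\<close>, and \<open>0\<close> is reserved for insertion into
  \<open>h\<close>.\<close>

fun movable :: "nat \<Rightarrow> nat \<times> nat set \<times> nat set \<Rightarrow> nat set" where
  "movable k (d, p, h) = {x. x < d \<and> x \<noteq> 0 \<and> x \<noteq> k \<and> (x \<in> p) \<noteq> (x \<in> h)}"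

fun move_down :: "nat \<Rightarrow> nat \<times> nat set \<times> nat set \<Rightarrow> nat \<times> nat set \<times> nat set" where
  "move_down k (d, p, h) = (let Y = movable k (d, p, h); B = lower_subset Y (h \<inter> Y)
    in (d, (p - Y) \<union> (Y - B), insert 0 ((h - Y) \<union> B)))"

section \<open>Four injections from \<open>skew_triples\<close> into
  \<open>even_triples\<close>\<close>

lemma finite_components:
  assumes "(d, p, h) \<in> skew_triples k N \<or> (d, p, h) \<in> even_triples k N" shows "finite p" "finite h"
  using assms unfolding skew_triples_def even_triples_def by (auto intro: finite_subset)

text \<open>Deleting \<open>0\<close> lowers only the cardinality of \<open>h\<close>; raising
  \<open>d\<close> by one restores the total \<open>N\<close>.\<close>

lemma card_skew_zero_le: "card (skew_triples k N \<inter> zero_in_h) \<le> card (even_triples k N - zero_in_h)"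
proof (rule card_inj_on_le)
  let ?f = "\<lambda>(d, p, h). (Suc d, p, h - {0::nat})"
  show "inj_on ?f (skew_triples k N \<inter> zero_in_h)" by (auto simp: inj_on_def zero_in_h_def)
  show "?f ` (skew_triples k N \<inter> zero_in_h) \<subseteq> even_triples k N - zero_in_h"
  proof (clarsimp simp: zero_in_h_def)
    fix d p h assume a: "(d, p, h) \<in> skew_triples k N" "0 \<in> h"
    note fin = finite_components[OF disjI1[OF a(1)]]
    have "\<Sum>h = \<Sum>(h - {0})" "card h = Suc (card (h - {0}))"
      using sum.remove[OF fin(2) a(2), of "\<lambda>x. x"] card_Suc_Diff1[OF fin(2) a(2)] by simp_all
    then show "(Suc d, p, h - {0}) \<in> even_triples k N"
      using a unfolding skew_triples_def even_triples_def by auto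
  qed
  show "finite (even_triples k N - zero_in_h)" using finite_even_triples by simp
qed

text \<open>The \<open>k\<close> deleted from \<open>h\<close> reappears in the new
  \<open>d\<close>; inserting \<open>0\<close> leaves the sums alone and brings \<open>p\<close> up
  to the size of \<open>h\<close>.\<close>

lemma card_low_skew_k_le:
  assumes "0 < k"
  shows "card (skew_triples k N \<inter> low_skew_k k) \<le> card (even_triples k N \<inter> low_even_0 k)"
proof (rule card_inj_on_le)
  let ?f = "\<lambda>(d, p, h). (d + k, insert 0 p, insert 0 (h - {k}))"
  show "inj_on ?f (skew_triples k N \<inter> low_skew_k k)"
    by (rule inj_on_inverseI[where g = "\<lambda>(d, q, g). (d - k, q - {0}, insert k (g - {0}))"])
      (auto simp: low_skew_k_def insert_absorb)
  show "?f ` (skew_triples k N \<inter> low_skew_k k) \<subseteq> even_triples k N \<inter> low_even_0 k"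
  proof (rule image_subsetI)
    fix t assume "t \<in> skew_triples k N \<inter> low_skew_k k"
    moreover obtain d p h where t: "t = (d, p, h)" by (cases t)
    ultimately have a: "(d, p, h) \<in> skew_triples k N" "0 \<notin> h" "0 \<notin> p" "k \<in> h" "p \<subseteq> {..<d}"
      by (auto simp: low_skew_k_def)
    note fin = finite_components[OF disjI1[OF a(1)]]
    have "\<Sum>h = k + \<Sum>(h - {k})" "card h = Suc (card (h - {k}))"
      using sum.remove[OF fin(2) a(4), of "\<lambda>x. x"] card_Suc_Diff1[OF fin(2) a(4)] by simp_all
    moreover have sub: "p \<subseteq> {..k + d} - {k}" "h \<subseteq> {..<d}" "card h = Suc (card p)"
      "d + \<Sum>p + \<Sum>h + card h = N" using a(1) by (auto simp: skew_triples_def)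
    moreover have "card (insert 0 p) = Suc (card p)" "\<Sum>(insert 0 p) = \<Sum>p"
      "card (insert 0 (h - {k})) = Suc (card (h - {k}))" "\<Sum>(insert 0 (h - {k})) = \<Sum>(h - {k})"
      using a(2,3) fin by simp_all
    ultimately have w: "card (insert 0 (h - {k})) = card (insert 0 p)"
      "(d + k) + \<Sum>(insert 0 p) + \<Sum>(insert 0 (h - {k})) + card (insert 0 (h - {k})) = N"
      by linarith+
    have "insert 0 p \<subseteq> {..k + (d + k)} - {k}" "insert 0 (h - {k}) \<subseteq> {..<d + k}"
      "insert 0 p \<union> insert 0 (h - {k}) \<subseteq> {..<d + k - k}" "2 * k < d + k"
      using sub(1,2) a(4,5) assms by force+
    with w show "?f t \<in> even_triples k N \<inter> low_even_0 k"
      using assms unfolding t even_triples_def low_even_0_def by simp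
  qed
  show "finite (even_triples k N \<inter> low_even_0 k)" using finite_even_triples by simp
qed

text \<open>Inserting \<open>k\<close> pays for lowering \<open>d\<close> by \<open>k\<close> and
  equalizes the cardinalities. The bound \<open>2 * k < d\<close> leaves room for \<open>k\<close>
  below \<open>d - k\<close>, and \<open>k \<notin> h\<close> allows \<open>h\<close> as the new
  first set.\<close>

lemma card_low_skew_0_le:
  assumes "0 < k"
  shows "card (skew_triples k N \<inter> low_skew_0 k) \<le> card (even_triples k N \<inter> low_even_k k)"
proof (rule card_inj_on_le)
  let ?f = "\<lambda>(d, p, h). (d - k, h, insert k p)"
  have kp: "k \<notin> p" if "(d, p, h) \<in> skew_triples k N" for d p h using that by (auto simp: skew_triples_def)
  show "inj_on ?f (skew_triples k N \<inter> low_skew_0 k)"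
    by (rule inj_on_inverseI[where g = "\<lambda>(d, q, g). (d + k, g - {k}, q)"])
      (auto simp: low_skew_0_def dest: kp)
  show "?f ` (skew_triples k N \<inter> low_skew_0 k) \<subseteq> even_triples k N \<inter> low_even_k k"
  proof (rule image_subsetI)
    fix t assume "t \<in> skew_triples k N \<inter> low_skew_0 k"
    moreover obtain d p h where t: "t = (d, p, h)" by (cases t)
    ultimately have a: "(d, p, h) \<in> skew_triples k N" "0 \<notin> h" "0 \<in> p" "k \<notin> h" "2 * k < d"
      "p \<subseteq> {..<d - k}" "h \<subseteq> {..<d - k}"
      by (auto simp: low_skew_0_def)
    note fin = finite_components[OF disjI1[OF a(1)]]
    show "?f t \<in> even_triples k N \<inter> low_even_k k"
    proof -
      have sub: "card h = Suc (card p)" "d + \<Sum>p + \<Sum>h + card h = N"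
        using a(1) by (auto simp: skew_triples_def)
      then have "card (insert k p) = card h" "d - k + \<Sum>h + \<Sum>(insert k p) + card (insert k p) = N"
        using kp[OF a(1)] fin(1) a(5) by simp_all
      moreover have "h \<subseteq> {..k + (d - k)} - {k}" "insert k p \<subseteq> {..<d - k}"
        using a(4-7) by force+
      ultimately show ?thesis
        using a(2,3,7) assms unfolding t even_triples_def low_even_k_def by simp
    qed
  qed
  show "finite (even_triples k N \<inter> low_even_k k)" using finite_even_triples by simp
qed

text \<open>Common elements cancel in \<open>card h = Suc (card p)\<close>. Besides these and the
  movable elements, \<open>h\<close> can contain only \<open>k\<close>, and \<open>p\<close> only
  \<open>0\<close> and elements from \<open>d\<close> on. Unless \<open>k \<in> h\<close> has no
  such counterpart in \<open>p\<close>, which is the case \<open>low_skew_k\<close>, the set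
  \<open>h\<close> has the majority of the movable elements.\<close>

lemma card_movable_less:
  assumes s: "(d, p, h) \<in> skew_triples k N" and z: "0 \<notin> h" and l: "(d, p, h) \<notin> low_skew_k k" and "0 < k"
  shows "card (movable k (d, p, h)) < 2 * card (h \<inter> movable k (d, p, h))"
proof -
  let ?Y = "movable k (d, p, h)" and ?P = "p \<inter> {x. x = 0 \<or> d \<le> x}"
  note fin = finite_components[OF disjI1[OF s]]
  have sub: "p \<subseteq> {..k + d} - {k}" "h \<subseteq> {..<d}" "card h = Suc (card p)"
    using s by (auto simp: skew_triples_def)
  have hpos: "0 < x" if "x \<in> h" for x using that z by (metis gr0I)
  have "card h = card ((h \<inter> p) \<union> (h \<inter> ?Y) \<union> (h \<inter> {k}))"
    by (rule arg_cong[of _ _ card]) (use sub z hpos in auto)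
  also have "\<dots> = card (h \<inter> p) + card (h \<inter> ?Y) + card (h \<inter> {k})"
    using fin sub by (subst card_Un_disjoint; auto)+
  finally have ch: "card h = card (h \<inter> p) + card (h \<inter> ?Y) + card (h \<inter> {k})" .
  have "card p = card ((h \<inter> p) \<union> (?Y - h) \<union> ?P)"
    by (rule arg_cong[of _ _ card]) (use sub z in auto)
  also have "\<dots> = card (h \<inter> p) + card (?Y - h) + card ?P"
    using fin sub z by (subst card_Un_disjoint; auto)+
  finally have cp: "card p = card (h \<inter> p) + card (?Y - h) + card ?P" .
  have cY: "card ?Y = card (h \<inter> ?Y) + card (?Y - h)"
    using card_Int_Diff[of ?Y h] by (simp add: Int_commute)
  have "card (h \<inter> {k}) \<le> card ?P"
  proof (cases "k \<in> h")
    case True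
    with l z have "0 \<in> p \<or> \<not> p \<subseteq> {..<d}" by (auto simp: low_skew_k_def)
    then have "?P \<noteq> {}" by force
    with fin have "card ?P \<noteq> 0" by auto
    with True show ?thesis by auto
  qed auto
  with ch cp cY sub(3) show ?thesis by linarith
qed

text \<open>Moving elements does not change which ones are movable, so the image determines the set
  on which \<open>lower_subset\<close> acted. There \<open>h\<close> loses one element, made up for
  by \<open>0\<close>, and \<open>p\<close> gains one.\<close>

lemma card_move_down_le:
  assumes "0 < k"
  shows "card (skew_triples k N - zero_in_h - low_skew_k k - low_skew_0 k)
    \<le> card (even_triples k N \<inter> zero_in_h - low_even_0 k - low_even_k k)" (is "card ?S \<le> card ?T")
proof (rule card_inj_on_le)
  have main: "move_down k t \<in> ?T \<and> movable k (move_down k t) = movable k t \<and>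
      snd (snd (move_down k t)) \<inter> movable k t = lower_subset (movable k t) (snd (snd t) \<inter> movable k t)"
    if t: "t \<in> ?S" for t
  proof -
    obtain d p h where tdef: "t = (d, p, h)" by (cases t) auto
    define Y where "Y = movable k (d, p, h)"
    define A where "A = h \<inter> Y"
    define B where "B = lower_subset Y A"
    have s: "(d, p, h) \<in> skew_triples k N" and z: "0 \<notin> h" and l: "(d, p, h) \<notin> low_skew_k k"
      and l': "(d, p, h) \<notin> low_skew_0 k" using t tdef by (auto simp: zero_in_h_def)
    note fin = finite_components[OF disjI1[OF s]]
    have finY: "finite Y" by (simp add: Y_def)
    have AY: "A \<subseteq> Y" by (simp add: A_def)
    have bal: "card Y < 2 * card A" using card_movable_less[OF s z l assms] by (simp add: Y_def A_def)
    note B = lower_subset[OF finY AY bal, folded B_def]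
    have finB: "finite B" using B(1) finY finite_subset by blast
    have im: "move_down k t = (d, (p - Y) \<union> (Y - B), insert 0 ((h - Y) \<union> B))"
      by (simp add: tdef Let_def Y_def A_def B_def del: movable.simps)
    have Yx: "x \<in> Y \<longleftrightarrow> x < d \<and> x \<noteq> 0 \<and> x \<noteq> k \<and> (x \<in> p) \<noteq> (x \<in> h)" for x
      by (simp add: Y_def)
    have sub: "p \<subseteq> {..k + d} - {k}" "h \<subseteq> {..<d}" "card h = Suc (card p)"
      "d + \<Sum>p + \<Sum>h + card h = N" using s by (auto simp: skew_triples_def)
    have A': "Y - A = p \<inter> Y" using Yx by (auto simp: A_def)
    have cY: "card Y = card A + card (p \<inter> Y)" "\<Sum>Y = \<Sum>A + \<Sum>(p \<inter> Y)"
      using card_Int_Diff[OF finY, of A] sum.subset_diff[OF AY finY, of "\<lambda>x. x"] AY A'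
      by (auto simp: Int_absorb1)
    have cYB: "card Y = card B + card (Y - B)" "\<Sum>Y = \<Sum>B + \<Sum>(Y - B)"
      using card_Int_Diff[OF finY, of B] sum.subset_diff[OF B(1) finY, of "\<lambda>x. x"] B(1)
      by (auto simp: Int_absorb1)
    have ch: "card h = card A + card (h - Y)" "\<Sum>h = \<Sum>A + \<Sum>(h - Y)"
      unfolding A_def using card_Int_Diff[OF fin(2), of Y] sum.Int_Diff[OF fin(2), of "\<lambda>x. x" Y]
      by auto
    have cp: "card p = card (p \<inter> Y) + card (p - Y)" "\<Sum>p = \<Sum>(p \<inter> Y) + \<Sum>(p - Y)"
      using card_Int_Diff[OF fin(1), of Y] sum.Int_Diff[OF fin(1), of "\<lambda>x. x" Y] by auto
    let ?q = "(p - Y) \<union> (Y - B)" and ?g = "insert 0 ((h - Y) \<union> B)"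
    have "0 \<notin> (h - Y) \<union> B" using z B(1) Yx by auto
    then have g: "card ?g = Suc (card (h - Y) + card B)" "\<Sum>?g = \<Sum>(h - Y) + \<Sum>B"
      using B(1) fin finB by (auto simp: card_Un_disjoint sum.union_disjoint subset_iff
        intro!: card_Un_disjoint sum.union_disjoint)
    have q: "card ?q = card (p - Y) + card (Y - B)" "\<Sum>?q = \<Sum>(p - Y) + \<Sum>(Y - B)"
      using fin finY by (auto intro!: card_Un_disjoint sum.union_disjoint)
    have d0: "0 < d" using sub(2,3) by (cases "d = 0") auto
    have "(d, ?q, ?g) \<in> even_triples k N"
      unfolding even_triples_def using g q cY cYB ch cp sub B d0 by (auto simp: Yx subset_iff)
    moreover have sdg: "movable k (d, ?q, ?g) = Y"
      using B(1) Yx by auto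
    moreover have fl: "0 \<in> ?q \<longleftrightarrow> 0 \<in> p" "k \<in> ?g \<longleftrightarrow> k \<in> h"
      using B(1) Yx assms by auto
    moreover have "(d, ?q, ?g) \<notin> low_even_0 k"
    proof
      assume a: "(d, ?q, ?g) \<in> low_even_0 k"
      \<comment> \<open>Moved elements stay in the union, so the bound in \<open>low_even_0\<close>
        carries back to the original triple.\<close>
      have "p \<union> h \<subseteq> ?q \<union> ?g" using Yx by auto
      with a have "(d, p, h) \<in> low_skew_0 k"
        using z fl by (auto simp: low_even_0_def low_skew_0_def)
      with l' show False by simp
    qed
    moreover have "(d, ?q, ?g) \<notin> low_even_k k"
    proof
      assume a: "(d, ?q, ?g) \<in> low_even_k k"
      have "p \<subseteq> ?q \<union> {..<d}" using Yx by auto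
      with a have "(d, p, h) \<in> low_skew_k k"
        using z fl by (auto simp: low_even_k_def low_skew_k_def)
      with l show False by simp
    qed
    moreover have "?g \<inter> Y = B" using B(1) Yx by auto
    ultimately show ?thesis
      unfolding im by (simp add: tdef zero_in_h_def Y_def A_def B_def del: movable.simps)
  qed
  show "move_down k ` ?S \<subseteq> ?T" using main by blast
  show "inj_on (move_down k) ?S"
  proof (rule inj_onI)
    fix t t' assume t: "t \<in> ?S" "t' \<in> ?S" and eq: "move_down k t = move_down k t'"
    obtain d p h where tdef: "t = (d, p, h)" by (cases t) auto
    obtain d' p' h' where tdef': "t' = (d', p', h')" by (cases t') auto
    define Y where "Y = movable k t"
    have Y': "movable k t' = Y" using main[OF t(1)] main[OF t(2)] eq by (simp add: Y_def)
    have bal: "card Y < 2 * card (h \<inter> Y)" "card Y < 2 * card (h' \<inter> Y)"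
      using card_movable_less[of d p h k N] card_movable_less[of d' p' h' k N] t assms Y'
      unfolding tdef tdef' Y_def by (auto simp: zero_in_h_def simp del: movable.simps)
    have finY: "finite Y" by (simp add: Y_def tdef)
    have "lower_subset Y (h \<inter> Y) = lower_subset Y (h' \<inter> Y)"
      using main[OF t(1)] main[OF t(2)] eq Y' by (simp add: Y_def tdef tdef')
    from lower_subset_inject[OF finY _ bal(1) _ bal(2) this]
    have hY: "h \<inter> Y = h' \<inter> Y" by simp
    define B where "B = lower_subset Y (h \<inter> Y)"
    have eqs: "d = d'" "(p - Y) \<union> (Y - B) = (p' - Y) \<union> (Y - B)"
      "insert 0 ((h - Y) \<union> B) = insert 0 ((h' - Y) \<union> B)"
      using eq Y' hY unfolding tdef tdef' move_down.simps Let_def B_def Y_def by (auto simp del: movable.simps)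
    have BY: "B \<subseteq> Y" unfolding B_def by (rule lower_subset(1)[OF finY _ bal(1)]) simp
    have z: "0 \<notin> h" "0 \<notin> h'" using t by (auto simp: tdef tdef' zero_in_h_def)
    have "h - Y = insert 0 ((h - Y) \<union> B) - Y - {0}" "h' - Y = insert 0 ((h' - Y) \<union> B) - Y - {0}"
      using BY z by auto
    with eqs(3) have "h - Y = h' - Y" by simp
    with hY have "h = h'" by blast
    have "p - Y = ((p - Y) \<union> (Y - B)) - Y" "p' - Y = ((p' - Y) \<union> (Y - B)) - Y" by auto
    with eqs(2) have "p - Y = p' - Y" by simp
    \<comment> \<open>An element of \<open>Y\<close> lies in exactly one of the two sets, so
      \<open>h\<close> decides whether it is in \<open>p\<close>.\<close>
    moreover have "x \<in> p \<longleftrightarrow> x \<in> p'" if "x \<in> Y" for x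
    proof -
      have "x \<in> movable k t" "x \<in> movable k t'" using that Y' by (simp_all add: Y_def)
      then show ?thesis using \<open>h = h'\<close> by (simp add: tdef tdef')
    qed
    ultimately have "p = p'" by blast
    with \<open>h = h'\<close> eqs(1) show "t = t'" by (simp add: tdef tdef')
  qed
  show "finite ?T" using finite_even_triples by simp
qed

text \<open>The sources have to cover, the targets to be disjoint: \<open>?T1\<close> has
  \<open>0 \<notin> h\<close>, the others \<open>0 \<in> h\<close>, and \<open>0 \<in> p\<close>
  separates \<open>low_even_0\<close> from \<open>low_even_k\<close>.\<close>

lemma card_skew_le_card_even:
  assumes "0 < k"
  shows "card (skew_triples k N) \<le> card (even_triples k N)"
proof -
  let ?S1 = "skew_triples k N \<inter> zero_in_h" and ?S2 = "skew_triples k N \<inter> low_skew_k k" and ?S3 = "skew_triples k N \<inter> low_skew_0 k"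
    and ?S4 = "skew_triples k N - zero_in_h - low_skew_k k - low_skew_0 k"
  let ?T1 = "even_triples k N - zero_in_h" and ?T2 = "even_triples k N \<inter> low_even_0 k" and ?T3 = "even_triples k N \<inter> low_even_k k"
    and ?T4 = "even_triples k N \<inter> zero_in_h - low_even_0 k - low_even_k k"
  have "card (skew_triples k N) = card (?S1 \<union> ?S2 \<union> ?S3 \<union> ?S4)"
    by (rule arg_cong[of _ _ card]) auto
  also have "\<dots> \<le> card ?S1 + card ?S2 + card ?S3 + card ?S4"
    by (meson add_le_mono card_Un_le le_refl le_trans)
  also have "\<dots> \<le> card ?T1 + card ?T2 + card ?T3 + card ?T4"
    by (intro add_mono card_skew_zero_le card_low_skew_k_le card_low_skew_0_le card_move_down_le assms)
  also have "\<dots> = card (?T1 \<union> ?T2 \<union> ?T3 \<union> ?T4)"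
  proof -
    have "?T1 \<inter> ?T2 = {}" "(?T1 \<union> ?T2) \<inter> ?T3 = {}" "(?T1 \<union> ?T2 \<union> ?T3) \<inter> ?T4 = {}"
      by (auto simp: zero_in_h_def low_even_0_def low_even_k_def)
    moreover have "finite ?T1" "finite ?T2" "finite ?T3" "finite ?T4"
      using finite_even_triples[of k N] by simp_all
    ultimately show ?thesis by (metis card_Un_disjoint finite_UnI)
  qed
  also have "\<dots> \<le> card (even_triples k N)"
    by (rule card_mono[OF finite_even_triples]) auto
  finally show ?thesis .
qed

section \<open>Frobenius symbols as pairs of sets\<close>

definition frobenius_pairs :: "nat \<Rightarrow> (nat set \<times> nat set) set" where
  "frobenius_pairs N = {(p, h). finite p \<and> finite h \<and> card p = card h \<and> \<Sum>p + \<Sum>h + card h = N}"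

lemma finite_frobenius_pairs: "finite (frobenius_pairs N)"
proof (rule finite_subset)
  show "frobenius_pairs N \<subseteq> Pow {..N} \<times> Pow {..N}"
  proof
    fix t assume "t \<in> frobenius_pairs N"
    then obtain p h where t: "t = (p, h)" "finite p" "finite h" "\<Sum>p + \<Sum>h + card h = N"
      by (auto simp: frobenius_pairs_def)
    have "x \<le> \<Sum>p" if "x \<in> p" for x using member_le_sum[of x p "\<lambda>x. x"] that t by simp
    moreover have "x \<le> \<Sum>h" if "x \<in> h" for x using member_le_sum[of x h "\<lambda>x. x"] that t by simp
    ultimately have "p \<subseteq> {..N}" "h \<subseteq> {..N}" using t(4) by fastforce+
    then show "t \<in> Pow {..N} \<times> Pow {..N}" by (simp add: t(1))
  qed
qed simp

text \<open>The condition of low rank after the two sets are exchanged. Equal cardinalities rule out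
  an empty \<open>h\<close>, for which the bound would be vacuous.\<close>

definition high_pairs :: "nat \<Rightarrow> nat \<Rightarrow> (nat set \<times> nat set) set" where
  "high_pairs k N = {(p, h) \<in> frobenius_pairs N. \<exists>x\<in>p. \<forall>z\<in>h. z + k + 2 \<le> x}"

definition pairs_containing :: "nat \<Rightarrow> nat \<Rightarrow> (nat set \<times> nat set) set" where
  "pairs_containing k N = {(p, h) \<in> frobenius_pairs N. k \<in> p}"

lemma high_pairs_subset:
  "high_pairs k N - pairs_containing k N \<subseteq> (\<lambda>(d, p, h). (insert (k + d + 1) p, h)) ` skew_triples k (N - k - 1)"
proof
  fix t assume "t \<in> high_pairs k N - pairs_containing k N"
  then obtain p h y where t: "t = (p, h)" "finite p" "finite h" "card p = card h"
    "\<Sum>p + \<Sum>h + card h = N" "y \<in> p" "\<forall>z\<in>h. z + k + 2 \<le> y" "k \<notin> p"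
    by (auto simp: high_pairs_def pairs_containing_def frobenius_pairs_def)
  define x where "x = Max p"
  have x: "x \<in> p" "\<And>y. y \<in> p \<Longrightarrow> y \<le> x" using t(2,6) by (auto simp: x_def intro: Max_in)
  have h: "\<forall>z\<in>h. z + k + 2 \<le> x" using t(7) x(2)[OF t(6)] by force
  have "h \<noteq> {}" using t(2-4,6) by fastforce
  with h have xk: "k + 2 \<le> x" by force
  \<comment> \<open>With this choice \<open>z + k + 2 \<le> x\<close> says exactly
    \<open>z < d\<close>; \<open>k + 2 \<le> x\<close> keeps the subtraction exact.\<close>
  define d where "d = x - k - 1"
  have xd: "x = k + d + 1" using xk by (simp add: d_def)
  have "\<Sum>p = x + \<Sum>(p - {x})" "card p = Suc (card (p - {x}))"
    using sum.remove[OF t(2) x(1), of "\<lambda>x. x"] card_Suc_Diff1[OF t(2) x(1)] by simp_all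
  then have "card h = Suc (card (p - {x}))" "d + \<Sum>(p - {x}) + \<Sum>h + card h = N - k - 1"
    using t(4,5) xd by simp_all
  moreover have "y \<le> k + d" if "y \<in> p - {x}" for y using x(2)[of y] that xd by auto
  then have "p - {x} \<subseteq> {..k + d} - {k}" using t(8) by auto
  moreover have "h \<subseteq> {..<d}" using h xd by auto
  ultimately have "(d, p - {x}, h) \<in> skew_triples k (N - k - 1)" by (simp add: skew_triples_def)
  moreover have "t = (\<lambda>(d, p, h). (insert (k + d + 1) p, h)) (d, p - {x}, h)"
    using t(1) x(1) xd by auto
  ultimately show "t \<in> (\<lambda>(d, p, h). (insert (k + d + 1) p, h)) ` skew_triples k (N - k - 1)" by blast
qed

text \<open>The maximum of the second set recovers \<open>d\<close>. Elements of the first set are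
  at most \<open>k + d\<close>, so the pair is not high. The bound \<open>k < N\<close> makes
  \<open>N - k - 1\<close> exact.\<close>

lemma card_even_triples_le:
  assumes "k < N"
  shows "card (even_triples k (N - k - 1)) \<le> card (pairs_containing k N - high_pairs k N)"
proof (rule card_inj_on_le)
  let ?f = "\<lambda>(d, q, g). (insert k q, insert d g)"
  have mx: "Max (insert d g) = d" if "(d, q, g) \<in> even_triples k M" for d q g M
    using that finite_components[OF disjI2[OF that]] by (auto simp: even_triples_def intro!: Max_eqI)
  show "inj_on ?f (even_triples k (N - k - 1))"
    by (rule inj_on_inverseI[where g = "\<lambda>(p, h). (Max h, p - {k}, h - {Max h})"])
      (auto simp: mx; auto simp: even_triples_def)
  show "?f ` even_triples k (N - k - 1) \<subseteq> pairs_containing k N - high_pairs k N"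
  proof (rule image_subsetI)
    fix t assume a: "t \<in> even_triples k (N - k - 1)"
    obtain d q g where t: "t = (d, q, g)" by (cases t)
    note fin = finite_components[OF disjI2[OF a[unfolded t]]]
    have *: "q \<subseteq> {..k + d} - {k}" "g \<subseteq> {..<d}" "card g = card q" "d + \<Sum>q + \<Sum>g + card g = N - k - 1"
      using a by (auto simp: t even_triples_def)
    then have "k \<notin> q" "d \<notin> g" by auto
    then have "card (insert k q) = Suc (card q)" "\<Sum>(insert k q) = k + \<Sum>q"
      "card (insert d g) = Suc (card g)" "\<Sum>(insert d g) = d + \<Sum>g" using fin by simp_all
    then have "(insert k q, insert d g) \<in> pairs_containing k N"
      using * fin assms by (simp add: pairs_containing_def frobenius_pairs_def)
    moreover have "x \<le> k + d" if "x \<in> insert k q" for x using that *(1) by auto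
    then have "(insert k q, insert d g) \<notin> high_pairs k N" by (fastforce simp: high_pairs_def)
    ultimately show "?f t \<in> pairs_containing k N - high_pairs k N" by (simp add: t)
  qed
  show "finite (pairs_containing k N - high_pairs k N)"
    by (rule finite_subset[OF _ finite_frobenius_pairs[of N]]) (auto simp: pairs_containing_def)
qed

lemma card_high_pairs_le:
  assumes "0 < k"
  shows "card (high_pairs k N) \<le> card (pairs_containing k N)"
proof -
  have fin: "finite (high_pairs k N)" "finite (pairs_containing k N)"
    by (rule finite_subset[OF _ finite_frobenius_pairs[of N]]; auto simp: high_pairs_def pairs_containing_def)+
  have "card (high_pairs k N - pairs_containing k N) \<le> card (pairs_containing k N - high_pairs k N)"
  proof (cases "k < N")
    case True
    have "card (high_pairs k N - pairs_containing k N) \<le> card (skew_triples k (N - k - 1))"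
      by (rule surj_card_le[OF finite_skew_triples high_pairs_subset])
    also have "\<dots> \<le> card (even_triples k (N - k - 1))" by (rule card_skew_le_card_even[OF assms])
    also have "\<dots> \<le> card (pairs_containing k N - high_pairs k N)" by (rule card_even_triples_le[OF True])
    finally show ?thesis .
  next
    case False
    \<comment> \<open>A nonempty \<open>h\<close> would force some \<open>x \<ge> k + 2\<close> into
      \<open>p\<close>, too large for \<open>N \<le> k\<close>.\<close>
    have "high_pairs k N = {}"
    proof (rule ccontr)
      assume "high_pairs k N \<noteq> {}"
      then obtain p h x where t: "finite p" "finite h" "card p = card h"
        "\<Sum>p + \<Sum>h + card h = N" "x \<in> p" "\<forall>z\<in>h. z + k + 2 \<le> x"
        by (auto simp: high_pairs_def frobenius_pairs_def)
      have "h \<noteq> {}" using t by fastforce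
      moreover have "x \<le> \<Sum>p" using member_le_sum[of x p "\<lambda>x. x"] t by simp
      ultimately show False using t(4,6) False by force
    qed
    then show ?thesis by simp
  qed
  moreover have "card (high_pairs k N) = card (high_pairs k N \<inter> pairs_containing k N) + card (high_pairs k N - pairs_containing k N)"
    by (rule card_Int_Diff[OF fin(1)])
  moreover have "card (pairs_containing k N) = card (high_pairs k N \<inter> pairs_containing k N) + card (pairs_containing k N - high_pairs k N)"
    using card_Int_Diff[OF fin(2), of "high_pairs k N"] by (simp add: Int_commute)
  ultimately show ?thesis by linarith
qed

section \<open>Frobenius coordinates\<close>

definition desc :: "nat list \<Rightarrow> bool" where
  "desc l \<longleftrightarrow> sorted_wrt (\<ge>) l \<and> (\<forall>x\<in>set l. 0 < x)"

definition partition_lists :: "nat \<Rightarrow> nat list set" where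
  "partition_lists n = {l. desc l \<and> sum_list l = n}"

text \<open>Records arm and leg of the corner cell and continues with the diagram without its first
  row and column, in which parts equal to \<open>1\<close> vanish.\<close>

function frobenius :: "nat list \<Rightarrow> (nat \<times> nat) list" where
  "frobenius [] = []"
| "frobenius (x # xs) = (x - 1, length xs) # frobenius (map (\<lambda>y. y - 1) (filter ((<) 1) xs))"
  by pat_completeness auto
termination
  by (relation "measure length") (auto simp: le_imp_less_Suc)

text \<open>Wraps a hook around the diagram of \<open>r\<close>; for nested coordinates the appended
  ones extend the first column to length \<open>Suc h\<close>.\<close>

fun of_frobenius :: "(nat \<times> nat) list \<Rightarrow> nat list" where
  "of_frobenius [] = []"
| "of_frobenius ((p, h) # r) = Suc p # map Suc (of_frobenius r) @ replicate (h - length (of_frobenius r)) 1"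

definition nested :: "(nat \<times> nat) list \<Rightarrow> bool" where
  "nested r \<longleftrightarrow> sorted_wrt (\<lambda>x y. fst y < fst x \<and> snd y < snd x) r"

text \<open>
  With the parts numbered from $1$, this says $\lambda_{i+1} = i + 1 + k$ for some $i$, that is, $k$ is one
  of the first Frobenius coordinates.
\<close>
fun diag :: "nat \<Rightarrow> nat list \<Rightarrow> bool" where
  "diag k [] \<longleftrightarrow> False"
| "diag k (x # xs) \<longleftrightarrow> x = Suc k \<or> diag (Suc k) xs"

lemma diag_map_Suc: "diag (Suc k) (map Suc l) \<longleftrightarrow> diag k l"
  by (induction l arbitrary: k) auto

lemma diag_append_ones: "0 < k \<Longrightarrow> diag k (l @ replicate m 1) \<longleftrightarrow> diag k l"
proof (induction l arbitrary: k)
  case Nil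
  then show ?case by (induction m arbitrary: k) auto
qed auto

lemma length_of_frobenius: "nested r \<Longrightarrow> length (of_frobenius r) = (case r of [] \<Rightarrow> 0 | x # _ \<Rightarrow> Suc (snd x))"
proof (induction r rule: of_frobenius.induct)
  case (2 p h r)
  then show ?case by (cases r) (auto simp: nested_def)
qed auto

lemma of_frobenius_le: "nested r \<Longrightarrow> y \<in> set (of_frobenius r) \<Longrightarrow> 0 < y \<and> y \<le> (case r of [] \<Rightarrow> 0 | x # _ \<Rightarrow> Suc (fst x))"
proof (induction r arbitrary: y rule: of_frobenius.induct)
  case (2 p h r)
  then show ?case by (cases r) (fastforce simp: nested_def)+
qed auto

lemma desc_of_frobenius: "nested r \<Longrightarrow> desc (of_frobenius r)"
proof (induction r rule: of_frobenius.induct)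
  case (2 p h r)
  have n: "nested r" using "2.prems" by (auto simp: nested_def)
  have "Suc y \<le> Suc p" if "y \<in> set (of_frobenius r)" for y
    using of_frobenius_le[OF n that] "2.prems" by (cases r) (auto simp: nested_def)
  moreover have "sorted_wrt (\<ge>) (replicate m (1::nat))" for m by (induction m) auto
  ultimately show ?case using "2.IH"(1)[OF n]
    by (auto simp: desc_def sorted_wrt_append sorted_wrt_map)
qed (auto simp: desc_def)

lemma sum_list_of_frobenius:
  "nested r \<Longrightarrow> sum_list (of_frobenius r) = sum_list (map fst r) + sum_list (map snd r) + length r"
proof (induction r rule: of_frobenius.induct)
  case (2 p h r)
  have n: "nested r" using "2.prems" by (auto simp: nested_def)
  have "length (of_frobenius r) \<le> h" using length_of_frobenius[OF n] "2.prems" by (cases r) (auto simp: nested_def)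
  moreover have "sum_list (map Suc l) = sum_list l + length l" for l by (induction l) auto
  ultimately show ?case using "2.IH"(1)[OF n] by (simp add: sum_list_replicate)
qed auto

lemma frobenius_of_frobenius: "nested r \<Longrightarrow> frobenius (of_frobenius r) = r"
proof (induction r rule: of_frobenius.induct)
  case (2 p h r)
  have n: "nested r" using "2.prems" by (auto simp: nested_def)
  have "length (of_frobenius r) \<le> h" using length_of_frobenius[OF n] "2.prems" by (cases r) (auto simp: nested_def)
  moreover have "filter ((<) 1) (map Suc (of_frobenius r)) = map Suc (of_frobenius r)"
    using of_frobenius_le[OF n] by (auto simp: filter_id_conv)
  ultimately show ?case using "2.IH"(1)[OF n] by (simp add: comp_def filter_replicate)
qed auto

lemma desc_split_ones:
  assumes "desc l" shows "l = filter ((<) 1) l @ replicate (count_list l 1) 1"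
  using assms
proof (induction l)
  case (Cons x xs)
  then have IH: "xs = filter ((<) 1) xs @ replicate (count_list xs 1) 1" by (auto simp: desc_def)
  show ?case
  proof (cases "x = 1")
    case True
    then have "\<forall>y\<in>set xs. y = 1" using Cons(2) by (force simp: desc_def)
    then have "filter ((<) 1) xs = []" by (auto simp: filter_empty_conv)
    then show ?thesis using IH True by simp
  next
    case False
    then have "1 < x" using Cons(2) by (auto simp: desc_def)
    then show ?thesis using IH by simp
  qed
qed simp

lemma desc_filter_pred: "desc l \<Longrightarrow> desc (map (\<lambda>y. y - 1) (filter ((<) 1) l))"
  by (induction l) (auto simp: desc_def intro: diff_le_mono)

lemma of_frobenius_frobenius: "desc l \<Longrightarrow> nested (frobenius l) \<and> of_frobenius (frobenius l) = l"
proof (induction l rule: frobenius.induct)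
  case (2 x xs)
  let ?ys = "map (\<lambda>y. y - 1) (filter ((<) 1) xs)"
  have dx: "desc xs" "0 < x" "\<forall>y\<in>set xs. y \<le> x" using 2(2) by (auto simp: desc_def)
  have IH: "nested (frobenius ?ys)" "of_frobenius (frobenius ?ys) = ?ys" using 2(1)[OF desc_filter_pred[OF dx(1)]] by auto
  have eq: "filter ((<) 1) xs = map Suc ?ys" by (auto simp: comp_def intro!: map_idI[symmetric])
  have len: "length xs - length ?ys = count_list xs 1"
    by (subst desc_split_ones[OF dx(1)]) simp
  have "of_frobenius (frobenius (x # xs)) = x # (filter ((<) 1) xs @ replicate (count_list xs 1) 1)"
    unfolding frobenius.simps of_frobenius.simps IH(2) eq[symmetric] len using dx(2) by simp
  also have "\<dots> = x # xs" using desc_split_ones[OF dx(1)] by simp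
  finally have b: "of_frobenius (frobenius (x # xs)) = x # xs" .
  have "nested ((x - 1, length xs) # frobenius ?ys)"
  proof (cases "frobenius ?ys")
    case (Cons z zs)
    have l: "length ?ys = Suc (snd z)" using length_of_frobenius[OF IH(1)] IH(2) Cons by simp
    have "?ys = Suc (fst z) # tl ?ys" using IH(2) Cons by (cases z) (metis of_frobenius.simps(2) fst_conv list.sel(3))
    then have "Suc (fst z) \<in> set ?ys" by (metis list.set_intros(1))
    then have "fst z < x - 1" using dx(3) by fastforce
    moreover have "snd z < length xs" using l length_filter_le[of "(<) 1" xs] by simp
    ultimately show ?thesis using IH(1) unfolding Cons by (force simp: nested_def)
  qed (simp add: nested_def)
  with b show ?case by simp
qed (simp add: nested_def)

section \<open>Partitions and their coordinate sets\<close>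

definition coords_of :: "nat list \<Rightarrow> nat set \<times> nat set" where
  "coords_of l = (fst ` set (frobenius l), snd ` set (frobenius l))"

lemma nested_sorted:
  assumes "nested r"
  shows "sorted_wrt (<) (rev (map fst r))" "sorted_wrt (<) (rev (map snd r))"
  using assms unfolding nested_def sorted_wrt_rev sorted_wrt_map by (auto elim: sorted_wrt_mono_rel[rotated])

text \<open>Both coordinates decrease strictly, so each set fixes the order of its coordinate, and
  with it the pairing.\<close>

lemma nested_eqI:
  assumes "nested r" "nested s" "fst ` set r = fst ` set s" "snd ` set r = snd ` set s"
  shows "r = s"
proof -
  have "rev (map fst r) = rev (map fst s)" "rev (map snd r) = rev (map snd s)"
    by (rule strict_sorted_equal; use nested_sorted[OF assms(1)] nested_sorted[OF assms(2)] assms(3,4) in simp)+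
  then show ?thesis by (metis rev_rev_ident zip_map_fst_snd)
qed

lemma nested_sums:
  assumes "nested r"
  shows "\<Sum>(fst ` set r) = sum_list (map fst r)" "\<Sum>(snd ` set r) = sum_list (map snd r)"
    "card (fst ` set r) = length r" "card (snd ` set r) = length r"
proof -
  have d: "distinct (map fst r)" "distinct (map snd r)"
    using nested_sorted[OF assms] by (metis distinct_rev strict_sorted_iff)+
  show "\<Sum>(fst ` set r) = sum_list (map fst r)" "\<Sum>(snd ` set r) = sum_list (map snd r)"
    using sum_list_distinct_conv_sum_set[OF d(1), of "\<lambda>x. x"] sum_list_distinct_conv_sum_set[OF d(2), of "\<lambda>x. x"]
    by simp_all
  show "card (fst ` set r) = length r" "card (snd ` set r) = length r"
    using distinct_card[OF d(1)] distinct_card[OF d(2)] by simp_all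
qed

lemma bij_betw_coords_of: "bij_betw coords_of (partition_lists N) (frobenius_pairs N)"
  unfolding bij_betw_def
proof (intro conjI subset_antisym)
  show "inj_on coords_of (partition_lists N)"
  proof (rule inj_onI)
    fix l l' assume "l \<in> partition_lists N" "l' \<in> partition_lists N" and eq: "coords_of l = coords_of l'"
    then have *: "nested (frobenius l)" "of_frobenius (frobenius l) = l" "nested (frobenius l')" "of_frobenius (frobenius l') = l'"
      using of_frobenius_frobenius by (auto simp: partition_lists_def)
    have "frobenius l = frobenius l'" using nested_eqI[OF *(1,3)] eq by (simp add: coords_of_def)
    then show "l = l'" using *(2,4) by metis
  qed
  show "coords_of ` partition_lists N \<subseteq> frobenius_pairs N"
  proof (rule image_subsetI)
    fix l assume "l \<in> partition_lists N"
    then have *: "nested (frobenius l)" "of_frobenius (frobenius l) = l" "sum_list l = N"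
      using of_frobenius_frobenius by (auto simp: partition_lists_def)
    then show "coords_of l \<in> frobenius_pairs N"
      using sum_list_of_frobenius[OF *(1)] nested_sums[OF *(1)] by (simp add: coords_of_def frobenius_pairs_def)
  qed
  show "frobenius_pairs N \<subseteq> coords_of ` partition_lists N"
  proof
    fix t assume "t \<in> frobenius_pairs N"
    then obtain p h where t: "t = (p, h)" "finite p" "finite h" "card p = card h" "\<Sum>p + \<Sum>h + card h = N"
      by (auto simp: frobenius_pairs_def)
    \<comment> \<open>Both sets are matched in increasing order, then reversed because nested lists
      start with the outermost hook.\<close>
    define r where "r = rev (zip (sorted_list_of_set p) (sorted_list_of_set h))"
    have len: "length (sorted_list_of_set p) = length (sorted_list_of_set h)" using t(4) by simp
    have n: "nested r"
      unfolding nested_def r_def sorted_wrt_rev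
      using strict_sorted_list_of_set[of p] strict_sorted_list_of_set[of h] len
      by (auto simp: sorted_wrt_iff_nth_less)
    have s: "fst ` set r = p" "snd ` set r = h"
      using len t(2,3) unfolding r_def set_rev set_map[symmetric] by (simp_all add: map_fst_zip map_snd_zip)
    have "of_frobenius r \<in> partition_lists N"
      using desc_of_frobenius[OF n] sum_list_of_frobenius[OF n] nested_sums[OF n] t(5) s by (simp add: partition_lists_def)
    moreover have "coords_of (of_frobenius r) = t" by (simp add: coords_of_def frobenius_of_frobenius[OF n] s t(1))
    ultimately show "t \<in> coords_of ` partition_lists N" by blast
  qed
qed

text \<open>Wrapping a hook moves each old part one place down and raises it by one, which preserves
  its distance from the diagonal; the appended ones are too small to count.\<close>

lemma diag_of_frobenius: "nested r \<Longrightarrow> diag k (of_frobenius r) \<longleftrightarrow> k \<in> fst ` set r"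
proof (induction r rule: of_frobenius.induct)
  case (2 p h r)
  have n: "nested r" using "2.prems" by (auto simp: nested_def)
  have "diag k (of_frobenius ((p, h) # r)) \<longleftrightarrow> k = p \<or> diag k (of_frobenius r)"
    by (auto simp: diag_append_ones[of "Suc k", simplified] diag_map_Suc)
  then show ?case using "2.IH"(1)[OF n] by auto
qed auto

lemma coords_of_pairs_containing_iff:
  assumes "l \<in> partition_lists N" shows "coords_of l \<in> pairs_containing k N \<longleftrightarrow> diag k l"
proof -
  have *: "nested (frobenius l)" "of_frobenius (frobenius l) = l" using of_frobenius_frobenius assms by (auto simp: partition_lists_def)
  then show ?thesis
    using diag_of_frobenius[OF *(1), of k] bij_betwE[OF bij_betw_coords_of] assms
    by (force simp: pairs_containing_def coords_of_def)
qed

text \<open>The largest arm is \<open>hd l - 1\<close> and the largest leg is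
  \<open>length l - 1\<close>.\<close>

lemma swap_coords_of_high_pairs:
  assumes "l \<in> partition_lists N" "l \<noteq> []" "hd l + k + 2 \<le> length l"
  shows "prod.swap (coords_of l) \<in> high_pairs k N"
proof -
  obtain x xs where l: "l = x # xs" using assms(2) by (cases l) auto
  have *: "nested (frobenius l)" using of_frobenius_frobenius assms by (auto simp: partition_lists_def)
  have "length xs \<in> snd (coords_of l)" by (simp add: coords_of_def l)
  moreover have "z \<le> x - 1" if "z \<in> fst (coords_of l)" for z
    using that * by (auto simp: coords_of_def nested_def l less_imp_le)
  then have "z + k + 2 \<le> length xs" if "z \<in> fst (coords_of l)" for z
    using that assms(1,3) by (fastforce simp: l partition_lists_def desc_def)
  moreover have "coords_of l \<in> frobenius_pairs N" using bij_betwE[OF bij_betw_coords_of] assms(1) by blast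
  ultimately show ?thesis
    by (cases "coords_of l") (auto simp: high_pairs_def frobenius_pairs_def)
qed

lemma finite_partition_lists: "finite (partition_lists N)"
  using finite_frobenius_pairs[of N] bij_betw_finite[OF bij_betw_coords_of] by blast

lemma card_low_rank_le_diag:
  assumes "0 < k"
  shows "card {l \<in> partition_lists N. l \<noteq> [] \<and> hd l + k + 2 \<le> length l} \<le> card {l \<in> partition_lists N. diag k l}"
proof -
  have fin: "finite (high_pairs k N)" "finite (partition_lists N)"
    using finite_frobenius_pairs[of N] bij_betw_finite[OF bij_betw_coords_of]
    by (auto simp: high_pairs_def elim: finite_subset[rotated])
  have inj: "inj_on coords_of (partition_lists N)" using bij_betw_coords_of by (rule bij_betw_imp_inj_on)
  have "card {l \<in> partition_lists N. l \<noteq> [] \<and> hd l + k + 2 \<le> length l} \<le> card (high_pairs k N)"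
  proof (rule card_inj_on_le[OF _ _ fin(1)])
    show "inj_on (prod.swap \<circ> coords_of) {l \<in> partition_lists N. l \<noteq> [] \<and> hd l + k + 2 \<le> length l}"
      by (rule comp_inj_on) (use inj in \<open>auto intro: inj_on_subset\<close>)
  qed (use swap_coords_of_high_pairs in fastforce)
  also have "\<dots> \<le> card (pairs_containing k N)" by (rule card_high_pairs_le[OF assms])
  also have "\<dots> \<le> card {l \<in> partition_lists N. diag k l}"
  proof (rule surj_card_le)
    show "pairs_containing k N \<subseteq> coords_of ` {l \<in> partition_lists N. diag k l}"
    proof
      fix t assume t: "t \<in> pairs_containing k N"
      then have "t \<in> coords_of ` partition_lists N"
        using bij_betw_imp_surj_on[OF bij_betw_coords_of] by (auto simp: pairs_containing_def)
      then show "t \<in> coords_of ` {l \<in> partition_lists N. diag k l}" using coords_of_pairs_containing_iff t by blast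
    qed
  qed (use fin in simp)
  finally show ?thesis .
qed

section \<open>Cranks and ranks\<close>

text \<open>For a decreasing list, the height \<open>j\<close> of its Durfee rectangle with
  \<open>j\<close> rows and \<open>j + k\<close> columns.\<close>

fun crest :: "nat \<Rightarrow> nat list \<Rightarrow> nat" where
  "crest k [] = 0"
| "crest k (x # xs) = (if k < x then Suc (crest (Suc k) xs) else 0)"

fun lift :: "nat \<Rightarrow> nat list \<Rightarrow> nat list" where
  "lift k [] = []"
| "lift k (x # xs) = (if k < x then Suc x # lift (Suc k) xs else x # xs)"

text \<open>Lifting leaves a gap: at the running \<open>k\<close>, a lifted part is at least
  \<open>k + 2\<close> and the first one left alone at most \<open>k\<close>.\<close>

fun unlift :: "nat \<Rightarrow> nat list \<Rightarrow> nat list" where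
  "unlift k [] = []"
| "unlift k (x # xs) = (if Suc k < x then (x - 1) # unlift (Suc k) xs else x # xs)"

lemma unlift_lift: "unlift k (lift k l) = l"
  by (induction l arbitrary: k) auto

lemma sum_list_lift: "sum_list (lift k l) = sum_list l + crest k l"
  by (induction l arbitrary: k) auto

lemma lift_le: "y \<in> set (lift k l) \<Longrightarrow> \<exists>x\<in>set l. x \<le> y \<and> y \<le> Suc x"
  by (induction l arbitrary: k) (auto split: if_splits, (metis le_SucI le_refl)?)

lemma desc_lift: "desc l \<Longrightarrow> desc (lift k l)"
proof (induction l arbitrary: k)
  case (Cons x xs)
  then have "desc xs" by (auto simp: desc_def)
  moreover have "y \<le> Suc x" if "y \<in> set (lift (Suc k) xs)" for y
    using lift_le[OF that] Cons.prems by (auto simp: desc_def)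
  ultimately show ?case using Cons by (auto simp: desc_def)
qed auto

lemma not_diag_small: "\<forall>y\<in>set l. y \<le> k \<Longrightarrow> \<not> diag k l"
  by (induction l arbitrary: k) (auto simp: le_SucI)

text \<open>The value \<open>Suc k\<close> sought by \<open>diag\<close> falls into the gap that
  \<open>lift\<close> creates; after the lifted parts, all parts are too small.\<close>

lemma not_diag_lift: "desc l \<Longrightarrow> \<not> diag k (lift k l)"
proof (induction l arbitrary: k)
  case (Cons x xs)
  then have d: "desc xs" by (auto simp: desc_def)
  show ?case
  proof (cases "k < x")
    case True
    then show ?thesis using Cons.IH[OF d] by simp
  next
    case False
    then have "\<forall>y\<in>set (x # xs). y \<le> k" using Cons.prems by (auto simp: desc_def)
    from not_diag_small[OF this] show ?thesis using False by simp
  qed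
qed simp

lemma crest_le_count:
  "desc l \<Longrightarrow> crest k l \<le> length (filter (\<lambda>x. k + crest k l \<le> x) l)"
proof (induction l arbitrary: k)
  case (Cons x xs)
  then have d: "desc xs" by (auto simp: desc_def)
  show ?case
  proof (cases "k < x")
    case True
    note IH = Cons.IH[OF d, of "Suc k"]
    have "Suc k + crest (Suc k) xs \<le> x"
    proof (cases "crest (Suc k) xs = 0")
      case False
      then have "filter (\<lambda>x. Suc k + crest (Suc k) xs \<le> x) xs \<noteq> []" using IH by auto
      then obtain y where "y \<in> set xs" "Suc k + crest (Suc k) xs \<le> y"
        by (auto simp: filter_empty_conv)
      then show ?thesis using Cons.prems by (force simp: desc_def)
    qed (use True in simp)
    then show ?thesis using True IH by simp
  qed simp
qed simp

lemma crest_append_ones: "0 < k \<Longrightarrow> crest k (l @ replicate m 1) = crest k l"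
proof (induction l arbitrary: k)
  case Nil
  then show ?case by (cases m) auto
qed auto

lemma length_filter_le_filter:
  "(\<And>x. P x \<Longrightarrow> Q x) \<Longrightarrow> length (filter P l) \<le> length (filter Q l)"
  by (induction l) auto

text \<open>For positive \<open>k\<close> this is crank at most \<open>- k\<close>: without ones the
  crank is nonnegative and the inequality fails.\<close>

definition low_crank_list :: "nat \<Rightarrow> nat list \<Rightarrow> bool" where
  "low_crank_list k l \<longleftrightarrow> length (filter ((<) (count_list l 1)) l) + k \<le> count_list l 1"

text \<open>With fewer ones, every row of the Durfee rectangle would exceed the number of ones and
  be counted by the crank, which would then be too large. The bound makes the subtraction in
  \<open>strip_ones\<close> exact.\<close>

lemma ones_ge_crest:
  assumes "desc l" "low_crank_list k l" "0 < k"
  shows "k + crest k (filter ((<) 1) l) \<le> count_list l 1"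
proof (rule ccontr)
  let ?s = "filter ((<) 1) l" and ?c = "count_list l 1"
  assume "\<not> ?thesis"
  then have less: "?c < k + crest k ?s" by simp
  have "desc ?s" using assms(1) by (simp add: desc_def sorted_wrt_filter)
  then have "crest k ?s \<le> length (filter (\<lambda>x. k + crest k ?s \<le> x) ?s)" by (rule crest_le_count)
  also have "\<dots> \<le> length (filter ((<) ?c) l)"
    unfolding filter_filter by (rule length_filter_le_filter) (use less in auto)
  finally show False using less assms(2) by (simp add: low_crank_list_def)
qed

text \<open>
  Together with \<open>lift\<close> this lowers the size by $k$: of the ones, $k$ are discarded and the others that
  are removed are added to the parts that \<open>crest\<close> counts, one to each.
\<close>
definition strip_ones :: "nat \<Rightarrow> nat list \<Rightarrow> nat list" where
  "strip_ones k l = (let s = filter ((<) 1) l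
    in s @ replicate (count_list l 1 - k - crest k s) 1)"

lemma count_list_replicate_same: "count_list (replicate m x) x = m"
  by (induction m) auto

lemma count_list_filter_gt: "count_list (filter ((<) 1) l) (1::nat) = 0"
  by (simp add: count_list_0_iff)

lemma card_low_crank_le:
  assumes "0 < k"
  shows "card {l \<in> partition_lists n. low_crank_list k l} \<le> card {l \<in> partition_lists (n - k). \<not> diag k l}"
proof (rule card_inj_on_le)
  let ?f = "\<lambda>l. lift k (strip_ones k l)"
  \<comment> \<open>Ones do not affect \<open>crest\<close>, so the number
    \<open>k + crest k s\<close> of removed ones can be computed after unlifting.\<close>
  let ?g = "\<lambda>t. let s = unlift k t in
    filter ((<) 1) s @ replicate (count_list s 1 + k + crest k s) 1"
  show "inj_on ?f {l \<in> partition_lists n. low_crank_list k l}"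
  proof (rule inj_on_inverseI[where g = ?g])
    fix l assume "l \<in> {l \<in> partition_lists n. low_crank_list k l}"
    then have l: "desc l" "low_crank_list k l" by (auto simp: partition_lists_def)
    let ?s = "filter ((<) 1) l"
    have "crest k (strip_ones k l) = crest k ?s"
      unfolding strip_ones_def Let_def by (rule crest_append_ones[OF assms])
    moreover have "filter ((<) 1) (strip_ones k l) = ?s"
      by (simp add: strip_ones_def Let_def filter_replicate)
    moreover have "count_list (strip_ones k l) 1 = count_list l 1 - k - crest k ?s"
      by (simp add: strip_ones_def Let_def count_list_replicate_same count_list_filter_gt[simplified])
    ultimately have "?g (?f l) = ?s @ replicate (count_list l 1) 1"
      using ones_ge_crest[OF l assms] by (simp add: unlift_lift Let_def)
    then show "?g (?f l) = l" using desc_split_ones[OF l(1)] by simp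
  qed
  show "?f ` {l \<in> partition_lists n. low_crank_list k l} \<subseteq> {l \<in> partition_lists (n - k). \<not> diag k l}"
  proof (rule image_subsetI)
    fix l assume "l \<in> {l \<in> partition_lists n. low_crank_list k l}"
    then have l: "desc l" "sum_list l = n" "low_crank_list k l" by (auto simp: partition_lists_def)
    let ?s = "filter ((<) 1) l"
    have "sum_list l = sum_list ?s + count_list l 1"
      by (subst desc_split_ones[OF l(1)]) (simp add: sum_list_replicate)
    moreover have "sum_list (?f l) = sum_list (strip_ones k l) + crest k ?s"
      unfolding sum_list_lift strip_ones_def Let_def crest_append_ones[OF assms] ..
    moreover have "sum_list (strip_ones k l) = sum_list ?s + (count_list l 1 - k - crest k ?s)"
      by (simp add: strip_ones_def Let_def sum_list_replicate)
    ultimately have "sum_list (?f l) = n - k" using ones_ge_crest[OF l(1,3) assms] l(2) by simp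
    moreover have d: "desc (strip_ones k l)"
    proof -
      have "sorted_wrt (\<ge>) (replicate m (1::nat))" for m by (induction m) auto
      then show ?thesis using l(1)
        by (auto simp: desc_def strip_ones_def Let_def sorted_wrt_append sorted_wrt_filter)
    qed
    ultimately show "?f l \<in> {l \<in> partition_lists (n - k). \<not> diag k l}"
      using desc_lift[OF d] not_diag_lift[OF d] by (simp add: partition_lists_def)
  qed
qed (simp add: finite_partition_lists)

section \<open>Dyson's map and the inequality for lists\<close>

definition top_part :: "nat list \<Rightarrow> nat" where
  "top_part l = (if l = [] then 0 else hd l)"

text \<open>The new column of \<open>top_part l + k\<close> cells fits because the negated rank
  bound gives \<open>length (tl l) \<le> top_part l + k\<close>. The new first part exceeds the old
  one by at most one.\<close>

lemma card_not_low_rank_le: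
  assumes "0 < k" "k \<le> n"
  shows "card {l \<in> partition_lists (n - k). \<not> (l \<noteq> [] \<and> hd l + k + 2 \<le> length l)}
    \<le> card {l \<in> partition_lists n. top_part l + k \<le> length l + 1}" (is "card ?A \<le> card ?B")
proof (rule card_inj_on_le)
  let ?f = "\<lambda>l. map Suc (tl l) @ replicate (top_part l + k - length (tl l)) 1"
  \<comment> \<open>The image has \<open>top_part l + k\<close> parts, so length \<open>k\<close>
    singles out the empty list, which is sent to \<open>k\<close> ones.\<close>
  let ?g = "\<lambda>t. if length t = k then [] else (length t - k) # map (\<lambda>x. x - 1) (filter ((<) 1) t)"
  have len: "length (?f l) = top_part l + k" and le: "length (tl l) \<le> top_part l + k" if "l \<in> ?A" for l
    using that by (auto simp: top_part_def)
  show "inj_on ?f ?A"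
  proof (rule inj_on_inverseI[where g = ?g])
    fix l assume l: "l \<in> ?A"
    have "filter ((<) 1) (map Suc (tl l)) = map Suc (tl l)"
      using l by (cases l) (auto simp: filter_id_conv partition_lists_def desc_def)
    then have "filter ((<) 1) (?f l) = map Suc (tl l)" by (simp add: filter_replicate)
    moreover have "l = [] \<longleftrightarrow> top_part l = 0"
      using l by (cases l) (auto simp: top_part_def partition_lists_def desc_def)
    moreover have "top_part l # tl l = l" if "l \<noteq> []" using that by (simp add: top_part_def)
    ultimately show "?g (?f l) = l" using len[OF l]
      by (cases "l = []") (auto simp: comp_def)
  qed
  show "?f ` ?A \<subseteq> ?B"
  proof (rule image_subsetI)
    fix l assume l: "l \<in> ?A"
    then have d: "desc l" "sum_list l = n - k" by (auto simp: partition_lists_def)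
    have tl: "\<forall>x\<in>set (tl l). x \<le> top_part l" "sorted_wrt (\<ge>) (tl l)"
      "sum_list l = top_part l + sum_list (tl l)"
      using d(1) by (cases l; auto simp: desc_def top_part_def)+
    have "sum_list (map Suc xs) = sum_list xs + length xs" for xs by (induction xs) auto
    then have "sum_list (?f l) = n"
      using le[OF l] d(2) tl(3) assms(2) by (simp add: sum_list_replicate)
    moreover have "sorted_wrt (\<ge>) (replicate m (1::nat))" for m by (induction m) auto
    then have "desc (?f l)" using tl(2) by (auto simp: desc_def sorted_wrt_append sorted_wrt_map)
    moreover have "top_part (?f l) \<le> Suc (top_part l)"
    proof (cases "?f l")
      case (Cons x xs)
      then have "x \<in> set (?f l)" by simp
      then show ?thesis using tl(1) Cons by (auto simp: top_part_def)
    qed (simp add: top_part_def)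
    ultimately show "?f l \<in> ?B" using len[OF l] by (simp add: partition_lists_def)
  qed
qed (simp add: finite_partition_lists)

lemma card_low_crank_le_low_rank:
  assumes "0 < k"
  shows "card {l \<in> partition_lists n. low_crank_list k l} \<le> card {l \<in> partition_lists n. top_part l + k \<le> length l + 1}"
proof (cases "k \<le> n")
  case True
  let ?P = "partition_lists (n - k)" and ?low = "\<lambda>l. l \<noteq> [] \<and> hd l + k + 2 \<le> length l"
  have split: "card {l \<in> ?P. Q l} + card {l \<in> ?P. \<not> Q l} = card ?P" for Q :: "nat list \<Rightarrow> bool"
    using card_Un_disjoint[of "{l \<in> ?P. Q l}" "{l \<in> ?P. \<not> Q l}"] finite_partition_lists[of "n - k"]
    by (simp add: Collect_disj_eq[symmetric] conj_disj_distribL[symmetric] disjoint_iff)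
  have "card {l \<in> partition_lists n. low_crank_list k l} \<le> card {l \<in> ?P. \<not> diag k l}"
    by (rule card_low_crank_le[OF assms])
  \<comment> \<open>Complementation in \<open>?P\<close> reverses
    \<open>card_low_rank_le_diag\<close>.\<close>
  also have "\<dots> \<le> card {l \<in> ?P. \<not> ?low l}"
    using split[of "diag k"] split[of ?low] card_low_rank_le_diag[OF assms, of "n - k"] by linarith
  also have "\<dots> \<le> card {l \<in> partition_lists n. top_part l + k \<le> length l + 1}"
    by (rule card_not_low_rank_le[OF assms True])
  finally show ?thesis .
next
  case False
  \<comment> \<open>A low crank requires at least \<open>k\<close> ones, impossible for
    \<open>n < k\<close>.\<close>
  have "count_list l 1 \<le> sum_list l" for l :: "nat list" by (induction l) auto
  moreover have "k \<le> count_list l 1" if "low_crank_list k l" for l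
    using that by (simp add: low_crank_list_def)
  ultimately have "k \<le> sum_list l" if "low_crank_list k l" for l using that le_trans by blast
  then have "{l \<in> partition_lists n. low_crank_list k l} = {}" using False by (auto simp: partition_lists_def)
  then show ?thesis by (metis card.empty zero_le)
qed

section \<open>Multisets and cumulative counts\<close>

lemma bij_betw_mset_partition_lists: "bij_betw mset (partition_lists n) (partitions n)"
  unfolding bij_betw_def
proof (intro conjI subset_antisym subsetI)
  show "inj_on mset (partition_lists n)"
  proof (rule inj_onI)
    fix l l' assume a: "l \<in> partition_lists n" "l' \<in> partition_lists n" "mset l = mset l'"
    have "sorted (rev l)" "sorted (rev l')"
      using a(1,2) by (auto simp: partition_lists_def desc_def sorted_wrt_rev)
    then have "rev l = rev l'" using a(3) by (metis mset_rev properties_for_sort)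
    then show "l = l'" by simp
  qed
next
  fix p assume "p \<in> mset ` partition_lists n"
  then show "p \<in> partitions n"
    by (auto simp: partition_lists_def desc_def partitions_def sum_mset_sum_list)
next
  fix p assume p: "p \<in> partitions n"
  let ?l = "rev (sorted_list_of_multiset p)"
  have "?l \<in> partition_lists n"
    using p sum_mset_sum_list[of "sorted_list_of_multiset p"]
    by (auto simp: partition_lists_def desc_def partitions_def sorted_wrt_rev)
  moreover have "p = mset ?l" by simp
  ultimately show "p \<in> mset ` partition_lists n" by blast
qed

lemma card_partitions_filter:
  "card {p \<in> partitions n. P p} = card {l \<in> partition_lists n. P (mset l)}"
proof -
  have "bij_betw mset {l \<in> partition_lists n. P (mset l)} {p \<in> partitions n. P p}"
    using bij_betw_mset_partition_lists[of n] by (auto simp: bij_betw_def inj_on_def)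
  then show ?thesis by (simp add: bij_betw_same_card)
qed

lemma finite_partitions: "finite (partitions n)"
  using bij_betw_finite[OF bij_betw_mset_partition_lists] finite_partition_lists by blast

text \<open>Only the finitely many values of \<open>f\<close> contribute. Confining the hypothesis
  to \<open>r \<le> m\<close> lets it cover \<open>Mcrank\<close> at \<open>n = 1\<close> for
  negative \<open>m\<close>.\<close>

lemma sum_card_fibres:
  fixes f :: "'a \<Rightarrow> int"
  assumes "finite A" "\<And>r. r \<le> m \<Longrightarrow> c r = int (card {x \<in> A. f x = r})"
  shows "(\<Sum>r\<in>{r. r \<le> m \<and> c r \<noteq> 0}. c r) = int (card {x \<in> A. f x \<le> m})"
proof -
  let ?B = "{x \<in> A. f x \<le> m}"
  have "int (card ?B) = (\<Sum>r\<in>f ` ?B. int (card {x \<in> ?B. f x = r}))"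
    using assms(1) sum.image_gen[of ?B "\<lambda>_. 1::int" f] by simp
  also have "\<dots> = (\<Sum>r\<in>f ` ?B. c r)"
  proof (rule sum.cong[OF refl])
    fix r assume "r \<in> f ` ?B"
    then have "r \<le> m" by auto
    then have "{x \<in> ?B. f x = r} = {x \<in> A. f x = r}" by auto
    then show "int (card {x \<in> ?B. f x = r}) = c r" using assms(2)[OF \<open>r \<le> m\<close>] by simp
  qed
  also have "\<dots> = (\<Sum>r\<in>{r. r \<le> m \<and> c r \<noteq> 0}. c r)"
  proof (rule sum.mono_neutral_right)
    show "{r. r \<le> m \<and> c r \<noteq> 0} \<subseteq> f ` ?B"
    proof
      fix r assume "r \<in> {r. r \<le> m \<and> c r \<noteq> 0}"
      then have r: "r \<le> m" "card {x \<in> A. f x = r} \<noteq> 0" using assms(2) by auto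
      then have "{x \<in> A. f x = r} \<noteq> {}" by (metis card.empty)
      then show "r \<in> f ` ?B" using r(1) by auto
    qed
  qed (use assms(1) in auto)
  finally show ?thesis by simp
qed

lemma Nrank_le_eq: "Nrank_le m n = int (card {p \<in> partitions n. prank p \<le> m})"
  unfolding Nrank_le_def by (rule sum_card_fibres[OF finite_partitions]) (simp add: Nrank_def)

lemma partitions_1: "partitions 1 = {{#1#}}"
proof -
  have "p = {#1#}" if "p \<in> partitions 1" for p
  proof -
    have pos: "\<forall>x\<in>#p. 0 < x" and s: "sum_mset p = 1" using that by (auto simp: partitions_def)
    then obtain x q where p: "p = add_mset x q" by (cases p) auto
    then have "0 < x" "x + sum_mset q = 1" using pos s by simp_all
    then have "x = 1" "sum_mset q = 0" by linarith+
    then have "q = {#}" using pos p by (cases q) auto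
    then show ?thesis using p \<open>x = 1\<close> by simp
  qed
  then show ?thesis by (auto simp: partitions_def)
qed

text \<open>At \<open>n = 1\<close> the convention departs from counting only at \<open>0\<close>
  and \<open>1\<close>, since the one partition has crank \<open>-1\<close>.\<close>

lemma Mcrank_neg:
  assumes "m < 0" shows "Mcrank m n = int (card {p \<in> partitions n. pcrank p = m})"
proof (cases "n = 1")
  case True
  have "pcrank {#1#} = -1" by (simp add: pcrank_def)
  then have "{p \<in> partitions n. pcrank p = m} = (if m = -1 then {{#1#}} else {})"
    using True partitions_1 by auto
  then show ?thesis using True assms by (simp add: Mcrank_def)
qed (simp add: Mcrank_def)

lemma Mcrank_le_eq:
  assumes "m < 0" shows "Mcrank_le m n = int (card {p \<in> partitions n. pcrank p \<le> m})"
  unfolding Mcrank_le_def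
  by (rule sum_card_fibres[OF finite_partitions]) (use assms Mcrank_neg in auto)

lemma largest_part_mset: "desc l \<Longrightarrow> largest_part (mset l) = top_part l"
  by (cases l) (auto simp: largest_part_def top_part_def desc_def intro!: Max_eqI)

lemma low_crank_listI:
  assumes "0 < k" "pcrank (mset l) \<le> - int k"
  shows "low_crank_list k l"
proof -
  have "size (filter_mset Q (mset l)) = length (filter Q l)" for Q
    by (metis mset_filter size_mset)
  with assms show ?thesis
    by (auto simp: pcrank_def low_crank_list_def count_mset split: if_splits)
qed

theorem theorem1p4:
  fixes m :: int and n :: nat
  assumes "m < 0" and "n \<ge> 1"
  shows "Mcrank_le m n \<le> Nrank_le (m + 1) n"
proof -
  define k where "k = nat (- m)"
  have k: "0 < k" "m = - int k" using assms(1) by (auto simp: k_def)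
  have "card {l \<in> partition_lists n. pcrank (mset l) \<le> m} \<le> card {l \<in> partition_lists n. low_crank_list k l}"
    by (rule card_mono) (use finite_partition_lists low_crank_listI[OF k(1)] k(2) in auto)
  also have "\<dots> \<le> card {l \<in> partition_lists n. top_part l + k \<le> length l + 1}"
    by (rule card_low_crank_le_low_rank[OF k(1)])
  also have "{l \<in> partition_lists n. top_part l + k \<le> length l + 1} = {l \<in> partition_lists n. prank (mset l) \<le> m + 1}"
    using largest_part_mset k(2) by (auto simp: prank_def partition_lists_def)
  finally show ?thesis
    unfolding Mcrank_le_eq[OF assms(1)] Nrank_le_eq card_partitions_filter by simp
qed

end
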